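(* Let $\Lambda$ be a linearly ordered set with no maximum, let $\{H_\lambda:\lambda\in\Lambda\}$ be a collection of non-trivial groups, each $H_\lambda$ being a transitive permutation group on a non-empty set $X_\lambda$, and let $W=\operatorname{Wr}_{\lambda\in\Lambda}H_\lambda$ be their (general) wreath product. Then $W$ is pseudocentral, i.e. $P(W)=W$.
   Context: For a group $G$, the pseudocentre is $P(G)=\bigcap_{x\in G}C_G(x)^G$, where $C_G(x)$ is the centralizer of $x$ in $G$ and, for a subgroup $H\leq G$, $H^G$ is the normal closure of $H$ in $G$. General wreath product: let $\Lambda$ be a linearly ordered set and, for each $\lambda\in\Lambda$, let $H_\lambda$ be a transitive permutation group on the non-empty set $X_\lambda$; fix $1_\lambda\in X_\lambda$. Let $X$ be the set of all families $(x_\lambda)_{\lambda\in\Lambda}$ with $x_\lambda\in X_\lambda$ and $x_\lambda\neq 1_\lambda$ for only finitely many $\lambda$, and put $1=(1_\lambda)_{\lambda}$. Write $x\equiv_\lambda y$ if $x_\mu=y_\mu$ for all $\mu>\lambda$. Each $\xi\in H_\lambda$ acts on $X$ as follows: if $x\not\equiv_\lambda 1$ then $(x)\xi=x$; if $x\equiv_\lambda 1$ then $(x)\xi$ is obtained from $x$ by replacing its $\lambda$-component $x_\lambda$ with $(x_\lambda)\xi$. This embeds $H_\lambda$ in $\operatorname{Sym}(X)$, and $W=\operatorname{Wr}_{\lambda\in\Lambda}H_\lambda$ is the subgroup of $\operatorname{Sym}(X)$ generated by all the $H_\lambda$ (up to isomorphism it does not depend on the choice of the $1_\lambda$). *)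

theory Defs
  imports
    "HOL-Algebra.Group_Action"
    "HOL-Algebra.Generated_Groups"
    "HOL-Algebra.Elementary_Groups"
begin

definition centralizer :: "[('a, 'b) monoid_scheme, 'a] \<Rightarrow> 'a set"
  where "centralizer G x = {g \<in> carrier G. g \<otimes>\<^bsub>G\<^esub> x = x \<otimes>\<^bsub>G\<^esub> g}"

definition normal_closure :: "[('a, 'b) monoid_scheme, 'a set] \<Rightarrow> 'a set"
  where "normal_closure G H = \<Inter> {N. N \<lhd> G \<and> H \<subseteq> N}"

definition pseudocentre :: "('a, 'b) monoid_scheme \<Rightarrow> 'a set"
  where "pseudocentre G = (\<Inter>x \<in> carrier G. normal_closure G (centralizer G x))"

definition pseudocentral :: "('a, 'b) monoid_scheme \<Rightarrow> bool"
  where "pseudocentral G \<longleftrightarrow> pseudocentre G = carrier G"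

abbreviation perm_group :: "['a set, ('a \<Rightarrow> 'a) set] \<Rightarrow> ('a \<Rightarrow> 'a) monoid"
  where "perm_group X H \<equiv> (BijGroup X)\<lparr>carrier := H\<rparr>"

definition transitive_perm_group :: "['a set, ('a \<Rightarrow> 'a) set] \<Rightarrow> bool"
  where "transitive_perm_group X H \<longleftrightarrow>
    X \<noteq> {} \<and> subgroup H (BijGroup X) \<and> transitive_action (perm_group X H) X (\<lambda>h. h)"

(* The family of base points is p, with p l in X l. Points are extensional functions on L,
   hence the base point of the set of all points is restrict p L. *)

definition wr_points :: "['l set, 'l \<Rightarrow> 'a set, 'l \<Rightarrow> 'a] \<Rightarrow> ('l \<Rightarrow> 'a) set"
  where "wr_points L X p = {x \<in> Pi\<^sub>E L X. finite {l \<in> L. x l \<noteq> p l}}"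

definition wr_equiv :: "['l::linorder set, 'l, 'l \<Rightarrow> 'a, 'l \<Rightarrow> 'a] \<Rightarrow> bool"
  where "wr_equiv L l x y \<longleftrightarrow> (\<forall>m \<in> L. l < m \<longrightarrow> x m = y m)"

definition wr_embed ::
  "['l::linorder set, 'l \<Rightarrow> 'a set, 'l \<Rightarrow> 'a, 'l, 'a \<Rightarrow> 'a] \<Rightarrow> ('l \<Rightarrow> 'a) \<Rightarrow> ('l \<Rightarrow> 'a)"
  where "wr_embed L X p l h =
    (\<lambda>x \<in> wr_points L X p. if wr_equiv L l x (restrict p L) then x(l := h (x l)) else x)"

(* BijGroup composes maps from right to left, whereas permutations written on the right of their
   arguments compose from left to right. The underlying sets of permutations agree, and the two
   group structures are opposite to each other, so they have the same subgroups, normal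
   subgroups and centralizers. *)

definition wreath_product ::
  "['l::linorder set, 'l \<Rightarrow> 'a set, 'l \<Rightarrow> 'a, 'l \<Rightarrow> ('a \<Rightarrow> 'a) set] \<Rightarrow>
    (('l \<Rightarrow> 'a) \<Rightarrow> ('l \<Rightarrow> 'a)) monoid"
  where "wreath_product L X p H =
    perm_group (wr_points L X p)
      (generate (BijGroup (wr_points L X p)) (\<Union>l \<in> L. wr_embed L X p l ` H l))"

lemma wr_embed_closed:
  assumes "l \<in> L" "h \<in> X l \<rightarrow> X l" "x \<in> wr_points L X p"
  shows "wr_embed L X p l h x \<in> wr_points L X p"
proof -
  have "finite {m \<in> L. (x(l := h (x l))) m \<noteq> p m}"
    by (rule finite_subset[of _ "insert l {m \<in> L. x m \<noteq> p m}"])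
       (use assms in \<open>auto simp: wr_points_def\<close>)
  moreover have "x(l := h (x l)) \<in> Pi\<^sub>E L X"
    using assms by (auto simp: wr_points_def PiE_iff extensional_def)
  ultimately show ?thesis
    using assms by (auto simp: wr_embed_def wr_points_def)
qed

lemma wr_embed_compose:
  assumes "l \<in> L" "g \<in> X l \<rightarrow> X l" "h \<in> X l \<rightarrow> X l"
  shows "wr_embed L X p l (compose (X l) g h) =
    compose (wr_points L X p) (wr_embed L X p l g) (wr_embed L X p l h)"
proof
  fix x
  show "wr_embed L X p l (compose (X l) g h) x =
    compose (wr_points L X p) (wr_embed L X p l g) (wr_embed L X p l h) x"
  proof (cases "x \<in> wr_points L X p")
    case True
    then have "x l \<in> X l" using assms(1) by (auto simp: wr_points_def)
    moreover have "wr_equiv L l (x(l := a)) y \<longleftrightarrow> wr_equiv L l x y" for a y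
      by (auto simp: wr_equiv_def)
    ultimately show ?thesis
      using True wr_embed_closed[OF assms(1,3) True]
      by (auto simp: compose_def wr_embed_def)
  qed (simp add: compose_def wr_embed_def)
qed

lemma wr_embed_one: "l \<in> L \<Longrightarrow> wr_embed L X p l (\<lambda>a \<in> X l. a) = (\<lambda>x \<in> wr_points L X p. x)"
  by (auto simp: wr_embed_def wr_points_def fun_eq_iff)

lemma wr_embed_Bij:
  assumes "l \<in> L" "h \<in> Bij (X l)"
  shows "wr_embed L X p l h \<in> Bij (wr_points L X p)"
proof -
  let ?P = "wr_points L X p" and ?k = "restrict (inv_into (X l) h) (X l)"
  have k: "?k \<in> Bij (X l)" using assms by (simp add: restrict_inv_into_Bij)
  have hk: "compose (X l) h ?k = (\<lambda>a \<in> X l. a)"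
    using assms by (auto simp: Bij_def bij_betw_def compose_def fun_eq_iff f_inv_into_f)
  have fs: "h \<in> X l \<rightarrow> X l" "?k \<in> X l \<rightarrow> X l"
    by (rule Bij_imp_funcset[OF assms(2)], rule Bij_imp_funcset[OF k])
  have 1: "compose ?P (wr_embed L X p l h) (wr_embed L X p l ?k) = (\<lambda>x \<in> ?P. x)"
    using wr_embed_compose[of l L h X ?k p, OF assms(1) fs] hk assms wr_embed_one by metis
  have 2: "compose ?P (wr_embed L X p l ?k) (wr_embed L X p l h) = (\<lambda>x \<in> ?P. x)"
    using wr_embed_compose[of l L ?k X h p, OF assms(1) fs(2,1)] Bij_compose_restrict_eq[OF assms(2)]
      assms wr_embed_one by metis
  have "bij_betw (wr_embed L X p l h) ?P ?P"
  proof (rule bij_betw_byWitness[where f' = "wr_embed L X p l ?k"])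
    show "\<forall>x\<in>?P. wr_embed L X p l ?k (wr_embed L X p l h x) = x"
      using fun_cong[OF 2] by (metis compose_eq restrict_apply')
    show "\<forall>x\<in>?P. wr_embed L X p l h (wr_embed L X p l ?k x) = x"
      using fun_cong[OF 1] by (metis compose_eq restrict_apply')
  qed (use wr_embed_closed[of l L _ X, OF assms(1)] fs in blast)+
  then show ?thesis by (auto simp: Bij_def wr_embed_def)
qed

lemma wr_embed_hom:
  assumes "l \<in> L"
  shows "wr_embed L X p l \<in> hom (BijGroup (X l)) (BijGroup (wr_points L X p))"
  using assms by (auto simp: hom_def BijGroup_def wr_embed_Bij wr_embed_compose Bij_imp_funcset)

lemma inj_on_wr_embed:
  assumes "l \<in> L" "\<And>m. m \<in> L \<Longrightarrow> p m \<in> X m"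
  shows "inj_on (wr_embed L X p l) (Bij (X l))"
proof (rule inj_onI)
  fix g h assume gh: "g \<in> Bij (X l)" "h \<in> Bij (X l)" "wr_embed L X p l g = wr_embed L X p l h"
  have "g a = h a" if a: "a \<in> X l" for a
  proof -
    let ?x = "(restrict p L)(l := a)"
    have "finite {m \<in> L. ?x m \<noteq> p m}" by (rule finite_subset[of _ "{l}"]) auto
    then have "?x \<in> wr_points L X p"
      using assms a by (auto simp: wr_points_def PiE_iff extensional_def)
    moreover have "wr_equiv L l ?x (restrict p L)" by (auto simp: wr_equiv_def)
    ultimately show ?thesis using fun_cong[OF gh(3), of ?x]
      by (simp add: wr_embed_def) (metis fun_upd_same)
  qed
  then show "g = h" using gh(1,2) by (intro extensionalityI[of _ "X l"]) (auto simp: Bij_def)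
qed

lemma group_wreath_product:
  assumes "\<And>l. l \<in> L \<Longrightarrow> subgroup (H l) (BijGroup (X l))"
  shows "group (wreath_product L X p H)"
proof -
  interpret B: group "BijGroup (wr_points L X p)" by (rule group_BijGroup)
  have "H l \<subseteq> Bij (X l)" if "l \<in> L" for l
    using subgroup.subset[OF assms[OF that]] by (simp add: BijGroup_def)
  then have "(\<Union>l \<in> L. wr_embed L X p l ` H l) \<subseteq> carrier (BijGroup (wr_points L X p))"
    using wr_embed_Bij by (fastforce simp: BijGroup_def)
  then show ?thesis
    unfolding wreath_product_def
    by (intro B.subgroup_imp_group B.generate_is_subgroup)
qed

end

theory Submission
  imports Defs
begin

text \<open>An element \<open>x\<close> of the wreath product is a product of finitely many elements of the groups
  \<open>H l\<close>, so, as \<open>L\<close> has no maximum, \<open>x\<close> and any given generator \<open>s\<close> move only points that agree with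
  the base point from some index \<open>m\<close> on. An element of \<open>H m\<close> that moves \<open>p m\<close> carries the set of
  these points to a disjoint set, so a conjugate of \<open>s\<close> commutes with \<open>x\<close>. Hence \<open>s\<close> lies in the
  normal closure of the centralizer of \<open>x\<close>.\<close>

lemma (in group) normal_closure_subset_carrier:
  "A \<subseteq> carrier G \<Longrightarrow> normal_closure G A \<subseteq> carrier G"
  using normal_invI[OF subgroup_self] unfolding normal_closure_def by auto

text \<open>A normal subgroup containing the centralizer of \<open>x\<close> contains a conjugate of
  each generator \<open>s\<close>, hence \<open>s\<close> itself, hence the whole group. The
  conjugating \<open>g\<close> may depend on both \<open>s\<close> and \<open>x\<close>.\<close>

lemma (in group) pseudocentralI:
  assumes S: "S \<subseteq> carrier G" and gen: "carrier G = generate G S"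
    and conj: "\<And>s x. \<lbrakk>s \<in> S; x \<in> carrier G\<rbrakk> \<Longrightarrow>
      \<exists>g \<in> carrier G. g \<otimes> s \<otimes> inv g \<in> centralizer G x"
  shows "pseudocentral G"
proof -
  have "carrier G \<subseteq> normal_closure G (centralizer G x)" if x: "x \<in> carrier G" for x
    unfolding normal_closure_def
  proof (intro Inter_greatest, clarsimp)
    fix N y assume N: "N \<lhd> G" "centralizer G x \<subseteq> N" and y: "y \<in> carrier G"
    have "S \<subseteq> N"
    proof
      fix s assume s: "s \<in> S"
      with conj x obtain g where g: "g \<in> carrier G" "g \<otimes> s \<otimes> inv g \<in> N"
        using N(2) by blast
      have "inv g \<otimes> (g \<otimes> s \<otimes> inv g) \<otimes> g \<in> N"
        by (rule normal.inv_op_closed1[OF N(1) g])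
      also have "inv g \<otimes> (g \<otimes> s \<otimes> inv g) \<otimes> g = s"
        using s S g(1) by (simp add: subset_eq m_assoc inv_solve_left')
      finally show "s \<in> N" .
    qed
    then show "y \<in> N"
      using generate_subgroup_incl[OF _ normal_imp_subgroup[OF N(1)]] gen y by blast
  qed
  \<comment> \<open>For the reverse inclusion one member of the intersection over \<open>x\<close>
    is enough, and \<open>\<one>\<close> is always available as an index.\<close>
  moreover have "normal_closure G (centralizer G \<one>) \<subseteq> carrier G"
    by (rule normal_closure_subset_carrier) (auto simp: centralizer_def)
  ultimately show ?thesis
    unfolding pseudocentral_def pseudocentre_def by blast
qed

text \<open>This is the pointwise stabilizer of \<open>P - A\<close> in the symmetric group on
  \<open>P\<close>. It is indexed by \<open>A\<close>, the region where points may move, because the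
  argument compares supports by inclusion and disjointness.\<close>

definition supported_perms :: "['a set, 'a set] \<Rightarrow> ('a \<Rightarrow> 'a) set"
  where "supported_perms P A = {f \<in> Bij P. \<forall>y \<in> P - A. f y = y}"

lemma supported_perms_mono: "A \<subseteq> B \<Longrightarrow> supported_perms P A \<subseteq> supported_perms P B"
  by (auto simp: supported_perms_def)

lemma Bij_imp_inj_on: "f \<in> Bij S \<Longrightarrow> inj_on f S"
  by (simp add: Bij_def bij_betw_def)

lemma subgroup_supported_perms: "subgroup (supported_perms P A) (BijGroup P)"
proof (rule group.subgroupI[OF group_BijGroup])
  show "supported_perms P A \<subseteq> carrier (BijGroup P)"
    by (auto simp: supported_perms_def BijGroup_def)
  show "supported_perms P A \<noteq> {}"
    using id_Bij[of P] by (auto simp: supported_perms_def)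
next
  fix f assume "f \<in> supported_perms P A"
  then show "inv\<^bsub>BijGroup P\<^esub> f \<in> supported_perms P A"
    by (auto simp: supported_perms_def inv_BijGroup restrict_inv_into_Bij
        intro!: inv_into_f_eq dest: Bij_imp_inj_on)
next
  fix f g assume "f \<in> supported_perms P A" "g \<in> supported_perms P A"
  then show "f \<otimes>\<^bsub>BijGroup P\<^esub> g \<in> supported_perms P A"
    by (auto simp: supported_perms_def BijGroup_def compose_Bij compose_eq)
qed

lemma supported_perms_commute:
  assumes f: "f \<in> supported_perms P A" and g: "g \<in> supported_perms P B"
    and disj: "A \<inter> B = {}"
  shows "f \<otimes>\<^bsub>BijGroup P\<^esub> g = g \<otimes>\<^bsub>BijGroup P\<^esub> f"
proof -
  \<comment> \<open>If \<open>k\<close> sent \<open>y\<close> into \<open>C\<close>, then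
    \<open>k y\<close> would lie outside \<open>D\<close> and be fixed by \<open>k\<close>;
    injectivity gives \<open>k y = y\<close>, contrary to \<open>y\<close> lying outside
    \<open>C\<close>. So \<open>k y\<close> stays outside \<open>C\<close>, where \<open>h\<close>
    fixes it.\<close>
  have moved: "h (k y) = k y"
    if "h \<in> supported_perms P C" "k \<in> supported_perms P D" "C \<inter> D = {}" "y \<in> P" "y \<notin> C"
    for h k C D y
  proof (cases "k y \<in> C")
    case True
    have kP: "k y \<in> P" and inj: "inj_on k P"
      using that by (auto simp: supported_perms_def Bij_def bij_betw_def)
    with True that have "k (k y) = k y" by (auto simp: supported_perms_def)
    with inj kP that(4) have "k y = y" by (auto dest: inj_onD)
    with that show ?thesis by (simp add: supported_perms_def)
  next
    case False
    with that show ?thesis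
      by (auto simp: supported_perms_def Bij_def bij_betw_def)
  qed
  have fg: "f (g y) = g (f y)" if "y \<in> P" for y
  proof (cases "y \<in> A")
    case True
    with disj have "y \<notin> B" by blast
    with moved[OF g f _ that] disj g that show ?thesis
      by (auto simp: supported_perms_def Int_commute)
  next
    case False
    with moved[OF f g disj that] f that show ?thesis
      by (auto simp: supported_perms_def)
  qed
  have "compose P f g = compose P g f"
    unfolding compose_def by (rule restrict_ext) (rule fg)
  then show ?thesis
    using f g by (simp add: supported_perms_def BijGroup_def)
qed

text \<open>The inverse of \<open>g\<close> takes a point outside the image of \<open>A\<close> to a
  point outside \<open>A\<close>; there \<open>f\<close> does nothing, and \<open>g\<close> takes it
  back. Maps compose from right to left, so \<open>g\<close> stands on the left of the
  conjugate.\<close>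

lemma supported_perms_conj:
  assumes f: "f \<in> supported_perms P A" and g: "g \<in> Bij P"
  shows "g \<otimes>\<^bsub>BijGroup P\<^esub> f \<otimes>\<^bsub>BijGroup P\<^esub> inv\<^bsub>BijGroup P\<^esub> g \<in> supported_perms P (g ` A)"
proof -
  let ?k = "\<lambda>x \<in> P. inv_into P g x"
  have fB: "f \<in> Bij P" and k: "?k \<in> Bij P"
    using f restrict_inv_into_Bij[OF g] by (auto simp: supported_perms_def)
  have surj: "g ` P = P" using g by (simp add: Bij_def bij_betw_def)
  have eq: "g \<otimes>\<^bsub>BijGroup P\<^esub> f \<otimes>\<^bsub>BijGroup P\<^esub> inv\<^bsub>BijGroup P\<^esub> g = compose P (compose P g f) ?k"
    unfolding inv_BijGroup[OF g] using g fB k compose_Bij[OF g fB] by (simp add: BijGroup_def)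
  have "g (f (inv_into P g y)) = y" if y: "y \<in> P" "y \<notin> g ` A" for y
  proof -
    have gy: "g (inv_into P g y) = y" and "inv_into P g y \<in> P"
      using y surj by (auto simp: f_inv_into_f inv_into_into)
    moreover from gy y(2) have "inv_into P g y \<notin> A" by (metis imageI)
    ultimately show ?thesis using f by (simp add: supported_perms_def)
  qed
  moreover have "inv_into P g y \<in> P" if "y \<in> P" for y
    using that surj by (simp add: inv_into_into)
  ultimately show ?thesis
    unfolding eq using compose_Bij[OF compose_Bij[OF g fB] k]
    by (simp add: supported_perms_def compose_eq)
qed

text \<open>By transitivity \<open>a\<close> can be sent to any other point of \<open>X\<close>.
  Such a point exists because extensional maps on a one-point set reduce to the identity, which
  would make \<open>H\<close> trivial.\<close>

lemma transitive_perm_group_moves: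
  assumes "transitive_perm_group X H" and "\<not> trivial_group (perm_group X H)" and a: "a \<in> X"
  obtains h where "h \<in> H" "h a \<noteq> a"
proof -
  interpret B: group "BijGroup X" by (rule group_BijGroup)
  have sub: "subgroup H (BijGroup X)" and tr: "transitive_action (perm_group X H) X (\<lambda>h. h)"
    using assms(1) by (auto simp: transitive_perm_group_def)
  have "X \<noteq> {a}"
  proof
    assume X: "X = {a}"
    have "H \<subseteq> {\<one>\<^bsub>BijGroup X\<^esub>}"
    proof
      fix h assume "h \<in> H"
      then have "h \<in> Bij X" using subgroup.subset[OF sub] by (auto simp: BijGroup_def)
      then have "h \<in> extensional X" and "h a = a"
        by (auto simp: Bij_def bij_betw_def X)
      then have "h = (\<lambda>x \<in> X. x)"
        by (intro extensionalityI[of _ X]) (simp_all add: X)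
      then show "h \<in> {\<one>\<^bsub>BijGroup X\<^esub>}" by (simp add: BijGroup_def)
    qed
    then have "H = {\<one>\<^bsub>BijGroup X\<^esub>}"
      using subgroup.one_closed[OF sub] by (intro subset_antisym) simp_all
    then have "carrier (perm_group X H) = {\<one>\<^bsub>perm_group X H\<^esub>}"
      by simp
    with assms(2) B.subgroup_imp_group[OF sub] show False
      unfolding trivial_group_def by blast
  qed
  then obtain b where "b \<in> X" "b \<noteq> a" using a by blast
  with transitive_action.unique_orbit[OF tr a] that show thesis by auto
qed

text \<open>In contrast to \<open>wr_equiv\<close>, the index \<open>m\<close> itself is included:
  coordinate \<open>m\<close> must be \<open>p m\<close>, so that an element of \<open>H m\<close>
  can push the whole set off itself. These sets form a chain increasing with
  \<open>m\<close>.\<close>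

definition wr_initial :: "['l::linorder set, 'l \<Rightarrow> 'a set, 'l \<Rightarrow> 'a, 'l] \<Rightarrow> ('l \<Rightarrow> 'a) set"
  where "wr_initial L X p m = {x \<in> wr_points L X p. \<forall>n \<in> L. m \<le> n \<longrightarrow> x n = p n}"

lemma wr_initial_mono: "m \<le> n \<Longrightarrow> wr_initial L X p m \<subseteq> wr_initial L X p n"
  by (auto simp: wr_initial_def)

text \<open>A moved point agrees with the base point strictly above \<open>l\<close>, but its
  coordinate \<open>l\<close> is arbitrary. Hence \<open>m\<close> has to be strictly larger than
  \<open>l\<close>.\<close>

lemma wr_embed_supported:
  assumes "l \<in> L" "h \<in> Bij (X l)" "l < m"
  shows "wr_embed L X p l h \<in> supported_perms (wr_points L X p) (wr_initial L X p m)"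
  using wr_embed_Bij[of l L h X p] assms
  by (auto simp: supported_perms_def wr_initial_def wr_embed_def wr_equiv_def)

text \<open>Induction on the generation of \<open>f\<close>: each generator is supported below some
  index, and for a product the larger of two indices serves, as the supports form a chain. The bound
  \<open>k\<close> lets one index be used for a second, given element as well.\<close>

lemma generate_wr_embed_supported:
  assumes no_max: "\<not> (\<exists>l \<in> L. \<forall>m \<in> L. m \<le> l)" and H: "\<And>l. l \<in> L \<Longrightarrow> H l \<subseteq> Bij (X l)"
    and f: "f \<in> generate (BijGroup (wr_points L X p)) (\<Union>l \<in> L. wr_embed L X p l ` H l)"
    and k: "k \<in> L"
  shows "\<exists>m \<in> L. k < m \<and> f \<in> supported_perms (wr_points L X p) (wr_initial L X p m)"
proof -
  let ?F = "\<lambda>m. supported_perms (wr_points L X p) (wr_initial L X p m)"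
  note sub = subgroup_supported_perms[of "wr_points L X p" "wr_initial L X p m" for m]
  have mono: "?F m \<subseteq> ?F n" if "m \<le> n" for m n
    by (intro supported_perms_mono wr_initial_mono that)
  have above: "\<exists>m \<in> L. l < m" if "l \<in> L" for l
    using no_max that by (meson not_le_imp_less)
  have gen: "\<exists>m \<in> L. k < m \<and> s \<in> ?F m" if s: "s \<in> (\<Union>l \<in> L. wr_embed L X p l ` H l)" for s
  proof -
    from s obtain l h where lh: "l \<in> L" "h \<in> H l" "s = wr_embed L X p l h" by blast
    have "max k l \<in> L" using k lh(1) by (simp add: max_def)
    from above[OF this] obtain m where "m \<in> L" "k < m" "l < m" by auto
    with lh H wr_embed_supported show ?thesis by blast
  qed
  show ?thesis using f
  proof induction
    case one
    with above[OF k] subgroup.one_closed[OF sub] show ?case by blast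
  next
    case (incl s)
    then show ?case by (rule gen)
  next
    case (inv s)
    with gen subgroup.m_inv_closed[OF sub] show ?case by blast
  next
    case (eng f g)
    then obtain m n where mn: "m \<in> L" "k < m" "f \<in> ?F m" "n \<in> L" "k < n" "g \<in> ?F n" by blast
    then have "f \<in> ?F (max m n)" "g \<in> ?F (max m n)"
      using mono[of m "max m n"] mono[of n "max m n"] by auto
    with subgroup.m_closed[OF sub] mn show ?case
      by (intro bexI[of _ "max m n"]) (auto simp: max_def)
  qed
qed

text \<open>Coordinate \<open>m\<close> separates the two sets: it is \<open>p m\<close> throughout
  the initial set and \<open>h (p m)\<close> throughout its image.\<close>

lemma wr_embed_displaces_initial:
  assumes "m \<in> L" "h (p m) \<noteq> p m"
  shows "wr_embed L X p m h ` wr_initial L X p m \<inter> wr_initial L X p m = {}"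
proof -
  have "wr_embed L X p m h x m = h (p m)" if "x \<in> wr_initial L X p m" for x
    using that assms(1) by (auto simp: wr_embed_def wr_initial_def wr_equiv_def)
  with assms show ?thesis by (fastforce simp: wr_initial_def)
qed

theorem theorem5p1:
  fixes L :: "'l::linorder set"
    and X :: "'l \<Rightarrow> 'a set"
    and p :: "'l \<Rightarrow> 'a"
    and H :: "'l \<Rightarrow> ('a \<Rightarrow> 'a) set"
  assumes no_max: "\<not> (\<exists>l \<in> L. \<forall>m \<in> L. m \<le> l)"
    and transitive: "\<And>l. l \<in> L \<Longrightarrow> transitive_perm_group (X l) (H l)"
    and nontrivial: "\<And>l. l \<in> L \<Longrightarrow> \<not> trivial_group (perm_group (X l) (H l))"
    and base: "\<And>l. l \<in> L \<Longrightarrow> p l \<in> X l"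
  shows "pseudocentral (wreath_product L X p H)"
proof -
  let ?P = "wr_points L X p" and ?W = "wreath_product L X p H"
  let ?S = "\<Union>l \<in> L. wr_embed L X p l ` H l"
  interpret B: group "BijGroup ?P" by (rule group_BijGroup)
  have Hsub: "subgroup (H l) (BijGroup (X l))" if "l \<in> L" for l
    using transitive[OF that] by (simp add: transitive_perm_group_def)
  have HB: "H l \<subseteq> Bij (X l)" if "l \<in> L" for l
    using subgroup.subset[OF Hsub[OF that]] by (simp add: BijGroup_def)
  then have SB: "?S \<subseteq> carrier (BijGroup ?P)"
    using wr_embed_Bij by (fastforce simp: BijGroup_def)
  have carr: "carrier ?W = generate (BijGroup ?P) ?S" by (simp add: wreath_product_def)
  have sub: "subgroup (carrier ?W) (BijGroup ?P)"
    unfolding carr by (rule B.generate_is_subgroup[OF SB])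
  have W: "?W = (BijGroup ?P)\<lparr>carrier := carrier ?W\<rparr>" by (simp add: wreath_product_def)
  have mult: "f \<otimes>\<^bsub>?W\<^esub> g = f \<otimes>\<^bsub>BijGroup ?P\<^esub> g" for f g by (simp add: wreath_product_def)
  have S: "?S \<subseteq> carrier ?W" unfolding carr by (blast intro: generate.incl)
  interpret W: group ?W by (rule group_wreath_product[OF Hsub])
  show ?thesis
  proof (rule W.pseudocentralI[OF S])
    \<comment> \<open>The carrier was generated inside the full symmetric group; generating inside
      the subgroup gives the same set.\<close>
    show "carrier ?W = generate ?W ?S"
      using B.generate_consistent[OF S sub] W carr by simp
  next
    fix s x assume s: "s \<in> ?S" and x: "x \<in> carrier ?W"
    from s obtain l h where lh: "l \<in> L" "h \<in> H l" "s = wr_embed L X p l h" by blast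
    \<comment> \<open>Taking the lower bound to be \<open>l\<close> puts \<open>s\<close> and
      \<open>x\<close> in the same support, \<open>wr_initial L X p m\<close>.\<close>
    obtain m where m: "m \<in> L" "l < m" and xm: "x \<in> supported_perms ?P (wr_initial L X p m)"
      using generate_wr_embed_supported[where X = X, OF no_max HB _ lh(1)] x carr by blast
    have sm: "s \<in> supported_perms ?P (wr_initial L X p m)"
      using wr_embed_supported[where X = X, OF lh(1) _ m(2)] HB lh by blast
    obtain h' where h': "h' \<in> H m" "h' (p m) \<noteq> p m"
      using transitive_perm_group_moves[OF transitive nontrivial base] m(1) by metis
    define g where "g = wr_embed L X p m h'"
    have g: "g \<in> carrier ?W" using S m(1) h'(1) by (auto simp: g_def)
    have gB: "g \<in> Bij ?P" using subgroup.subset[OF sub] g by (auto simp: BijGroup_def)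
    have inv: "inv\<^bsub>?W\<^esub> g = inv\<^bsub>BijGroup ?P\<^esub> g"
      using B.m_inv_consistent[OF sub g] W by simp
    have "g \<otimes>\<^bsub>?W\<^esub> s \<otimes>\<^bsub>?W\<^esub> inv\<^bsub>?W\<^esub> g \<in> centralizer ?W x"
    proof -
      have "g \<otimes>\<^bsub>?W\<^esub> s \<otimes>\<^bsub>?W\<^esub> inv\<^bsub>?W\<^esub> g \<in> carrier ?W" using g s S by blast
      \<comment> \<open>The conjugate of \<open>s\<close> is supported on this image, which misses
        the support of \<open>x\<close>.\<close>
      moreover have "g ` wr_initial L X p m \<inter> wr_initial L X p m = {}"
        unfolding g_def by (rule wr_embed_displaces_initial) (use m(1) h'(2) in auto)
      ultimately show ?thesis
        using supported_perms_commute[OF supported_perms_conj[OF sm gB] xm]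
        by (simp add: centralizer_def mult inv)
    qed
    then show "\<exists>g \<in> carrier ?W. g \<otimes>\<^bsub>?W\<^esub> s \<otimes>\<^bsub>?W\<^esub> inv\<^bsub>?W\<^esub> g \<in> centralizer ?W x"
      by (rule bexI[of _ g]) (rule g)
  qed
qed

end
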